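(* Let $(X,d)$ be a Hadamard space and let $f:X\times X\to\mathbb{R}$ be a bifunction such that, for constants $\gamma,\eta>0$: (1) $f$ is pseudomonotone: for all $x,y\in X$, $f(x,y)\ge0$ implies $f(y,x)\le 0$; (2) for every $x\in X$, $f(x,\cdot)$ is strongly quasiconvex with modulus $\gamma$; (3) $f(x,z)-f(x,y)-f(y,z)\le\eta\,(d^2(x,y)+d^2(y,z))$ for all $x,y,z\in X$; (4) $12\eta<\gamma$. Let $\{\beta_k\}_{k\in\mathbb{N}}\subseteq\left[\frac{1}{\gamma-8\eta},\frac{1}{4\eta}\right]$, let $x_0\in X$, and consider the method $$x_{k+1}\in\operatorname*{argmin}_{y\in X}\left\{f(x_k,y)+\frac{1}{2\beta_k}d^2(x_k,y)\right\}\qquad(k\in\mathbb{N}).$$ Suppose that this method is well-defined (the argmin sets are nonempty) and let $\{x_k\}_k$ be a sequence generated by it. Suppose that $S(f)=\{x^*\in X\mid f(x^*,y)\ge0\text{ for all }y\in X\}\neq\emptyset$. Then $\{x_k\}_k$ converges (in the metric $d$) to the unique element $x^*$ of $S(f)$. Further, if $b>0$ satisfies $b^2\ge d^2(x_0,x^* )$, then for all $k>2$ $$d(x_k,x^* )<\frac{C}{\sqrt{k-2}},\qquad\text{where } C:=\frac{12\sqrt{3}\,b\,\gamma^2}{\sqrt{\eta}\,(\gamma-12\eta)^{3/2}}.$$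
   Context: A Hadamard space is a complete CAT(0) space (complete geodesic metric space of nonpositive curvature). Such a space is uniquely geodesic, and $(1-\lambda)x\oplus\lambda y$ denotes the point at distance $\lambda d(x,y)$ from $x$ on the unique geodesic joining $x$ to $y$. A function $h:X\to\mathbb{R}$ is strongly quasiconvex with modulus $\gamma>0$ if $h((1-\lambda)x\oplus\lambda y)\le\max\{h(x),h(y)\}-\lambda(1-\lambda)\frac{\gamma}{2}d^2(x,y)$ for all $x,y\in X$, $\lambda\in[0,1]$. Elements of $S(f)$ are called equilibrium points of $f$. *)

theory Defs
  imports "HOL-Analysis.Analysis"
begin

definition geodesic_from_to :: "(real \<Rightarrow> 'a::metric_space) \<Rightarrow> 'a \<Rightarrow> 'a \<Rightarrow> bool" where
  "geodesic_from_to c x y \<longleftrightarrow> c 0 = x \<and> c (dist x y) = y \<and>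
     (\<forall>s\<in>{0..dist x y}. \<forall>t\<in>{0..dist x y}. dist (c s) (c t) = \<bar>s - t\<bar>)"

text \<open>
  Comparison of geodesic triangles with their Euclidean comparison triangles \<open>p' q' r'\<close>;
  \<open>u'\<close> and \<open>v'\<close> are the comparison points of \<open>c s\<close> and \<open>e t\<close>. It suffices to compare points
  on two sides issuing from a common vertex \<open>p\<close>: any two sides of a triangle share a vertex,
  geodesics can be reversed, and for points on the same side the comparison is trivial.
\<close>
class cat0_space = metric_space +
  assumes geodesic_exists: "\<exists>c. geodesic_from_to c x y"
    and cat0_comparison:
      "\<And>c e p q r s t. \<And>p' q' r' u' v' :: real^2.
         \<lbrakk> geodesic_from_to c p q; geodesic_from_to e p r;
           s \<in> {0..dist p q}; t \<in> {0..dist p r};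
           dist p' q' = dist p q; dist q' r' = dist q r; dist p' r' = dist p r;
           u' \<in> closed_segment p' q'; dist p' u' = s;
           v' \<in> closed_segment p' r'; dist p' v' = t \<rbrakk>
         \<Longrightarrow> dist (c s) (e t) \<le> dist u' v'"

class hadamard_space = complete_space + cat0_space

text \<open>
  \<open>geo_comb \<lambda> x y\<close> is the point \<open>(1 - \<lambda>) x \<oplus> \<lambda> y\<close>, for \<open>\<lambda> \<in> [0, 1]\<close>; it is well-defined in
  CAT(0) spaces, as these are uniquely geodesic.
\<close>
definition geo_comb :: "real \<Rightarrow> 'a::cat0_space \<Rightarrow> 'a \<Rightarrow> 'a" where
  "geo_comb l x y = (THE z. \<exists>c. geodesic_from_to c x y \<and> z = c (l * dist x y))"

definition strongly_quasiconvex :: "real \<Rightarrow> ('a::cat0_space \<Rightarrow> real) \<Rightarrow> bool" where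
  "strongly_quasiconvex \<gamma> h \<longleftrightarrow> \<gamma> > 0 \<and>
     (\<forall>x y. \<forall>l\<in>{0..1}.
        h (geo_comb l x y) \<le> max (h x) (h y) - l * (1 - l) * (\<gamma> / 2) * (dist x y)\<^sup>2)"

definition pseudomonotone :: "('a \<Rightarrow> 'a \<Rightarrow> real) \<Rightarrow> bool" where
  "pseudomonotone f \<longleftrightarrow> (\<forall>x y. f x y \<ge> 0 \<longrightarrow> f y x \<le> 0)"

definition equilibrium_points :: "('a \<Rightarrow> 'a \<Rightarrow> real) \<Rightarrow> 'a set" where
  "equilibrium_points f = {x. \<forall>y. f x y \<ge> 0}"

definition argmin_set :: "('a \<Rightarrow> real) \<Rightarrow> 'a set" where
  "argmin_set g = {y. is_arg_min g (\<lambda>_. True) y}"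

end

(* Testing the minimality of x_{k+1} against the point (1 - l) x_{k+1} + l x* with
   l = 2 * eta * beta_k makes the terms in d(x_k, x_{k+1}) cancel and leaves
   ((1 - l)(1 + gamma * beta_k) - 1) d(x_{k+1}, x* )^2 <= d(x_k, x* )^2 for every
   equilibrium point x*. The factor on the left is at least 1 + eta (gamma - 12 eta) / gamma^2
   for all admissible beta_k, so convergence is even linear; uniqueness of the equilibrium point
   is uniqueness of limits, and Bernoulli's inequality yields the (weaker) stated rate. *)
theory Submission
  imports Defs
begin

section \<open>Euclidean comparison triangles and the CAT(0) inequality\<close>

lemma euclidean_triangle_exists:
  fixes a b c :: real
  assumes "0 \<le> a" "0 \<le> b" "0 \<le> c" "a \<le> b + c" "b \<le> a + c" "c \<le> a + b"
  obtains p q r :: "real^2" where "dist p q = a" "dist q r = b" "dist p r = c"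
proof -
  \<comment> \<open>The triangle is placed with \<open>p\<close> at the origin and \<open>q\<close>
    at \<open>(a, 0)\<close>. The law of cosines then dictates the first coordinate \<open>X\<close>
    of \<open>r\<close>, and the triangle inequalities amount to
    \<open>\<bar>X\<bar> \<le> c\<close>, so that \<open>Y\<close> is a genuine square root. For
    \<open>a = 0\<close> they force \<open>b = c\<close>, and \<open>(c, 0)\<close> serves as
    \<open>r\<close>.\<close>
  define X where "X = (if a = 0 then c else (a\<^sup>2 + c\<^sup>2 - b\<^sup>2) / (2 * a))"
  define Y where "Y = sqrt (c\<^sup>2 - X\<^sup>2)"
  have "\<bar>X\<bar> \<le> c"
  proof (cases "a = 0")
    case False
    have "(a - c)\<^sup>2 \<le> b\<^sup>2"
      using assms by (intro abs_le_square_iff[THEN iffD1]) auto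
    moreover have "b\<^sup>2 \<le> (a + c)\<^sup>2"
      using assms by (intro power_mono) auto
    ultimately show ?thesis
      using False assms(1) by (auto simp: X_def abs_le_iff field_simps power2_eq_square)
  qed (use assms in \<open>simp add: X_def\<close>)
  then have "X\<^sup>2 \<le> c\<^sup>2"
    using assms by (intro abs_le_square_iff[THEN iffD1]) auto
  then have Y: "Y\<^sup>2 = c\<^sup>2 - X\<^sup>2"
    by (simp add: Y_def)
  have "(a - X)\<^sup>2 + Y\<^sup>2 = b\<^sup>2"
  proof (cases "a = 0")
    case True
    with assms have "b = c" by simp
    with True Y show ?thesis by simp
  next
    case False
    then have "2 * a * X = a\<^sup>2 + c\<^sup>2 - b\<^sup>2" by (simp add: X_def)
    with Y show ?thesis by (simp add: power2_diff)
  qed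
  then have b: "sqrt ((a - X)\<^sup>2 + Y\<^sup>2) = b"
    using assms by simp
  have c: "sqrt (X\<^sup>2 + Y\<^sup>2) = c"
    using assms Y by simp
  have dist2: "dist (vector [s, t]) (vector [u, v] :: real^2) = sqrt ((s - u)\<^sup>2 + (t - v)\<^sup>2)"
    for s t u v
    by (simp add: dist_vec_def L2_set_def sum_2 dist_real_def)
  show ?thesis
    by (rule that[of "vector [0, 0]" "vector [a, 0]" "vector [X, Y]"])
      (use assms(1) b c in \<open>simp_all add: dist2\<close>)
qed

text \<open>Stewart's theorem in vector form: the Euclidean equality behind the CAT(0) inequality
  that follows.\<close>

lemma dist_affine_combination_sq:
  fixes p q r :: "'a::real_inner"
  shows "(dist ((1 - l) *\<^sub>R p + l *\<^sub>R q) r)\<^sup>2 =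
    (1 - l) * (dist p r)\<^sup>2 + l * (dist q r)\<^sup>2 - l * (1 - l) * (dist p q)\<^sup>2"
  unfolding dist_norm power2_norm_eq_inner
  by (simp add: inner_diff_left inner_diff_right inner_add_left inner_add_right
      inner_commute algebra_simps)

text \<open>Comparison bounds the distance by its Euclidean counterpart, which Stewart's theorem
  evaluates. The case \<open>l = 1/2\<close> is the Bruhat-Tits (CN) inequality.\<close>

lemma cat0_geodesic_ineq:
  fixes x y z :: "'a::cat0_space"
  assumes c: "geodesic_from_to c x y" and l: "l \<in> {0..1}"
  shows "(dist (c (l * dist x y)) z)\<^sup>2
    \<le> (1 - l) * (dist x z)\<^sup>2 + l * (dist y z)\<^sup>2 - l * (1 - l) * (dist x y)\<^sup>2"
proof -
  obtain e where e: "geodesic_from_to e x z"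
    using geodesic_exists by blast
  obtain p q r :: "real^2" where tri: "dist p q = dist x y" "dist q r = dist y z" "dist p r = dist x z"
    by (rule euclidean_triangle_exists[of "dist x y" "dist y z" "dist x z"])
      (auto simp: dist_triangle dist_triangle2 dist_triangle3 add.commute)
  define u where "u = (1 - l) *\<^sub>R p + l *\<^sub>R q"
  have "p - u = l *\<^sub>R (p - q)"
    by (simp add: u_def algebra_simps)
  then have pu: "dist p u = l * dist x y"
    using l tri by (simp add: dist_norm)
  have useg: "u \<in> closed_segment p q"
    using l by (auto simp: u_def closed_segment_def)
  \<comment> \<open>The geodesic \<open>e\<close> is followed to its end \<open>z\<close>, whose
    comparison point is the vertex \<open>r\<close> itself.\<close>
  have "dist (c (l * dist x y)) (e (dist x z)) \<le> dist u r"
    by (rule cat0_comparison[OF c e _ _ tri useg pu])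
      (use l tri in \<open>auto simp: mult_left_le_one_le\<close>)
  then have "(dist (c (l * dist x y)) z)\<^sup>2 \<le> (dist u r)\<^sup>2"
    using e by (simp add: geodesic_from_to_def)
  then show ?thesis
    by (simp add: u_def dist_affine_combination_sq tri)
qed

text \<open>In the CAT(0) inequality for \<open>c\<close>, taking the corresponding point of
  \<open>e\<close> as \<open>z\<close> makes the right-hand side vanish. This justifies the definite
  description in \<open>geo_comb\<close>.\<close>

lemma geodesic_from_to_unique:
  fixes x y :: "'a::cat0_space"
  assumes c: "geodesic_from_to c x y" and e: "geodesic_from_to e x y" and l: "l \<in> {0..1}"
  shows "c (l * dist x y) = e (l * dist x y)"
proof -
  define d where "d = dist x y"
  have mem: "l * d \<in> {0..d}" "0 \<in> {0..d}" "d \<in> {0..d}"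
    using l by (auto simp: d_def mult_left_le_one_le)
  have "dist (e 0) (e (l * d)) = \<bar>0 - l * d\<bar>" "dist (e d) (e (l * d)) = \<bar>d - l * d\<bar>"
    using e mem unfolding geodesic_from_to_def d_def by blast+
  then have "(dist x (e (l * d)))\<^sup>2 = (l * d)\<^sup>2" "(dist y (e (l * d)))\<^sup>2 = (d - l * d)\<^sup>2"
    using e by (auto simp: geodesic_from_to_def d_def)
  with cat0_geodesic_ineq[OF c l, of "e (l * d)"]
  have "(dist (c (l * d)) (e (l * d)))\<^sup>2
      \<le> (1 - l) * (l * d)\<^sup>2 + l * (d - l * d)\<^sup>2 - l * (1 - l) * d\<^sup>2"
    by (simp add: d_def)
  also have "\<dots> = 0"
    by algebra
  finally show ?thesis
    by (simp add: d_def)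
qed

lemma geo_comb_eq:
  fixes x y :: "'a::cat0_space"
  assumes "geodesic_from_to c x y" "l \<in> {0..1}"
  shows "geo_comb l x y = c (l * dist x y)"
  unfolding geo_comb_def
  using assms geodesic_from_to_unique by (intro the_equality) blast+

lemma dist_geo_comb_sq_le:
  fixes x y z :: "'a::cat0_space"
  assumes "l \<in> {0..1}"
  shows "(dist z (geo_comb l x y))\<^sup>2
    \<le> (1 - l) * (dist z x)\<^sup>2 + l * (dist z y)\<^sup>2 - l * (1 - l) * (dist x y)\<^sup>2"
proof -
  obtain c where "geodesic_from_to c x y"
    using geodesic_exists by blast
  with cat0_geodesic_ineq[OF this assms, of z] assms show ?thesis
    by (simp add: geo_comb_eq dist_commute)
qed

section \<open>The effect of one proximal step on the distance to an equilibrium point\<close>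

lemma proximal_step_ineq:
  fixes f :: "'a::cat0_space \<Rightarrow> 'a \<Rightarrow> real"
  assumes pm: "pseudomonotone f"
    and sq: "strongly_quasiconvex \<gamma> (f x)"
    and lip: "\<And>u v w. f u w - f u v - f v w \<le> \<eta> * ((dist u v)\<^sup>2 + (dist v w)\<^sup>2)"
    and eta: "\<eta> > 0" and beta: "\<beta> > 0" "2 * \<eta> * \<beta> \<le> 1"
    and x': "x' \<in> argmin_set (\<lambda>y. f x y + 1 / (2 * \<beta>) * (dist x y)\<^sup>2)"
    and s: "s \<in> equilibrium_points f"
  shows "((1 - 2 * \<eta> * \<beta>) * (1 + \<gamma> * \<beta>) - 1) * (dist x' s)\<^sup>2 \<le> (dist x s)\<^sup>2"
proof -
  define l where "l = 2 * \<eta> * \<beta>"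
  define y where "y = geo_comb l x' s"
  have l: "l \<in> {0..1}"
    using eta beta by (auto simp: l_def)
  have nonpos: "f u s \<le> 0" for u
    using s pm by (auto simp: equilibrium_points_def pseudomonotone_def)
  have min: "f x x' + 1 / (2 * \<beta>) * (dist x x')\<^sup>2 \<le> f x y + 1 / (2 * \<beta>) * (dist x y)\<^sup>2"
    using x' by (auto simp: argmin_set_def is_arg_min_linorder)
  have "f x y \<le> max (f x x') (f x s) - l * (1 - l) * (\<gamma> / 2) * (dist x' s)\<^sup>2"
    using sq l by (auto simp: strongly_quasiconvex_def y_def)
  \<comment> \<open>Only \<open>f x s\<close> needs an argument: the three-point condition is used
    with \<open>x'\<close> as the middle point, and the resulting term \<open>f x' s\<close> is
    dropped because it is nonpositive.\<close>
  moreover have "max (f x x') (f x s) \<le> f x x' + \<eta> * ((dist x x')\<^sup>2 + (dist x' s)\<^sup>2)"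
    using lip[of x s x'] nonpos[of x'] eta by (auto intro!: mult_nonneg_nonneg)
  moreover have "1 / (2 * \<beta>) * (dist x y)\<^sup>2 \<le> 1 / (2 * \<beta>) *
      ((1 - l) * (dist x x')\<^sup>2 + l * (dist x s)\<^sup>2 - l * (1 - l) * (dist x' s)\<^sup>2)"
    using dist_geo_comb_sq_le[OF l] beta unfolding y_def by (intro mult_left_mono) auto
  ultimately have "1 / (2 * \<beta>) * (dist x x')\<^sup>2 \<le>
      \<eta> * ((dist x x')\<^sup>2 + (dist x' s)\<^sup>2) - l * (1 - l) * (\<gamma> / 2) * (dist x' s)\<^sup>2 +
      1 / (2 * \<beta>) * ((1 - l) * (dist x x')\<^sup>2 + l * (dist x s)\<^sup>2 - l * (1 - l) * (dist x' s)\<^sup>2)"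
    using min by linarith
  \<comment> \<open>Since \<open>l / (2 * \<beta>) = \<eta>\<close>, the loss \<open>\<eta>\<close>
    from the three-point condition is offset by the convexity gain in the coefficient of
    \<open>dist x x'\<close>, and \<open>\<eta>\<close> factors out of all that remains.\<close>
  also have "\<dots> = 1 / (2 * \<beta>) * (dist x x')\<^sup>2 +
      \<eta> * ((dist x s)\<^sup>2 - ((1 - l) * (1 + \<gamma> * \<beta>) - 1) * (dist x' s)\<^sup>2)"
    using beta by (simp add: l_def field_simps power2_eq_square)
  finally show ?thesis
    using eta by (simp add: l_def zero_le_mult_iff)
qed

text \<open>The slacks \<open>v\<close> and \<open>w\<close> of the two bounds on
  \<open>\<beta>\<close> cannot both be small, as \<open>w + v * ((t - 8) / 4)\<close> has the fixed
  value \<open>(t - 12) / 4\<close>. The factor exceeds 2 by exactly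
  \<open>w * (1 + v) / 2 + v * (1 - v)\<close>, and this is compared term by term with
  \<open>4 / t^2\<close> times the fixed value, which is the claimed gain.\<close>

lemma step_factor_ge:
  fixes \<gamma> \<eta> \<beta> :: real
  assumes eta: "\<eta> > 0" and gam: "12 * \<eta> < \<gamma>"
    and beta: "\<beta> \<in> {1 / (\<gamma> - 8 * \<eta>) .. 1 / (4 * \<eta>)}"
  shows "1 + \<eta> * (\<gamma> - 12 * \<eta>) / \<gamma>\<^sup>2 \<le> (1 - 2 * \<eta> * \<beta>) * (1 + \<gamma> * \<beta>) - 1"
proof -
  define t where "t = \<gamma> / \<eta>"
  define v where "v = 1 - 4 * \<eta> * \<beta>"
  define w where "w = (\<gamma> - 8 * \<eta>) * \<beta> - 1"
  have t: "t > 12" and \<gamma>: "\<gamma> = t * \<eta>"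
    using eta gam by (auto simp: t_def field_simps)
  have v: "v \<ge> 0" and w: "w \<ge> 0"
    using eta gam beta by (auto simp: v_def w_def field_simps)
  have wv: "w + v * ((t - 8) / 4) = (t - 12) / 4"
    by (simp add: v_def w_def \<gamma> diff_divide_distrib add_divide_distrib algebra_simps)
  have "(t - 8) * (1 - v) = 4 + 4 * w"
    by (simp add: v_def w_def \<gamma> algebra_simps)
  \<comment> \<open>The lower bound on \<open>\<beta>\<close> keeps \<open>v\<close> away from 1, so
    \<open>v * (1 - v)\<close> is bounded below by a multiple of \<open>v\<close>.\<close>
  with w have "(t - 8) * (1 - v) \<ge> 4"
    by simp
  then have v': "1 - v \<ge> 4 / (t - 8)"
    using t by (simp add: field_simps)
  have "4 / t\<^sup>2 * w \<le> 1 / 2 * w"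
  proof (intro mult_right_mono w)
    have "12\<^sup>2 \<le> t\<^sup>2" using t by (intro power_mono) auto
    then show "4 / t\<^sup>2 \<le> 1 / 2" by (simp add: divide_le_eq)
  qed
  also have "\<dots> \<le> w * (1 + v) / 2"
    using v w by (simp add: algebra_simps)
  finally have 1: "4 / t\<^sup>2 * w \<le> w * (1 + v) / 2" .
  have "(t - 8) / t\<^sup>2 \<le> 4 / (t - 8)"
  proof -
    have "(t - 8) * (t - 8) \<le> t * t" using t by (intro mult_mono) auto
    also have "\<dots> \<le> 4 * t\<^sup>2" using t by (simp add: power2_eq_square)
    finally show ?thesis using t by (simp add: field_simps)
  qed
  with v' have "v * ((t - 8) / t\<^sup>2) \<le> v * (1 - v)"
    using v by (intro mult_left_mono) auto
  with 1 have "4 / t\<^sup>2 * (w + v * ((t - 8) / 4)) \<le> w * (1 + v) / 2 + v * (1 - v)"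
    using t by (simp add: field_simps)
  also have "4 / t\<^sup>2 * (w + v * ((t - 8) / 4)) = \<eta> * (\<gamma> - 12 * \<eta>) / \<gamma>\<^sup>2"
    using eta t unfolding wv \<gamma> by (simp add: field_simps power2_eq_square)
  also have "w * (1 + v) / 2 + v * (1 - v) = (1 - 2 * \<eta> * \<beta>) * (1 + \<gamma> * \<beta>) - 2"
    by (simp add: v_def w_def field_simps)
  finally show ?thesis
    by simp
qed

section \<open>Convergence, uniqueness and the explicit rate\<close>

theorem theorem4p14:
  fixes f :: "'a::hadamard_space \<Rightarrow> 'a \<Rightarrow> real"
    and \<gamma> \<eta> :: real
    and \<beta> :: "nat \<Rightarrow> real"
    and x0 :: 'a
    and x :: "nat \<Rightarrow> 'a"
  assumes "\<gamma> > 0" and "\<eta> > 0"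
    and "pseudomonotone f"
    and "\<And>u. strongly_quasiconvex \<gamma> (f u)"
    and "\<And>u v w. f u w - f u v - f v w \<le> \<eta> * ((dist u v)\<^sup>2 + (dist v w)\<^sup>2)"
    and "12 * \<eta> < \<gamma>"
    and "\<And>k. \<beta> k \<in> {1 / (\<gamma> - 8 * \<eta>) .. 1 / (4 * \<eta>)}"
    and "x 0 = x0"
    and "\<And>k. x (Suc k) \<in> argmin_set (\<lambda>y. f (x k) y + 1 / (2 * \<beta> k) * (dist (x k) y)\<^sup>2)"
    and "equilibrium_points f \<noteq> {}"
  shows "\<exists>xs. equilibrium_points f = {xs} \<and> x \<longlonglongrightarrow> xs \<and>
           (\<forall>b::real. b > 0 \<and> b\<^sup>2 \<ge> (dist x0 xs)\<^sup>2 \<longrightarrow>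
              (\<forall>k::nat. k > 2 \<longrightarrow>
                 dist (x k) xs <
                   (12 * sqrt 3 * b * \<gamma>\<^sup>2 / (sqrt \<eta> * (\<gamma> - 12 * \<eta>) powr (3/2))) / sqrt (real k - 2)))"
proof -
  \<comment> \<open>A gain independent of \<open>k\<close>, so that steps with varying
    \<open>\<beta> k\<close> compound geometrically.\<close>
  define \<theta> where "\<theta> = \<eta> * (\<gamma> - 12 * \<eta>) / \<gamma>\<^sup>2"
  have theta: "\<theta> > 0"
    using assms(1,2,6) by (simp add: \<theta>_def)
  have contraction: "(1 + \<theta>) * (dist (x (Suc k)) s)\<^sup>2 \<le> (dist (x k) s)\<^sup>2"
    if s: "s \<in> equilibrium_points f" for s k
  proof -
    have "0 < 1 / (\<gamma> - 8 * \<eta>)"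
      using assms(2,6) by simp
    also have "\<dots> \<le> \<beta> k"
      using assms(7)[of k] by simp
    finally have "\<beta> k > 0" .
    moreover from assms(7)[of k] assms(2) have "2 * \<eta> * \<beta> k \<le> 1"
      by (simp add: field_simps)
    ultimately have "((1 - 2 * \<eta> * \<beta> k) * (1 + \<gamma> * \<beta> k) - 1) * (dist (x (Suc k)) s)\<^sup>2 \<le> (dist (x k) s)\<^sup>2"
      by (rule proximal_step_ineq[OF assms(3,4,5) assms(2) _ _ assms(9) s])
    moreover have "(1 + \<theta>) * (dist (x (Suc k)) s)\<^sup>2
        \<le> ((1 - 2 * \<eta> * \<beta> k) * (1 + \<gamma> * \<beta> k) - 1) * (dist (x (Suc k)) s)\<^sup>2"
      unfolding \<theta>_def by (intro mult_right_mono step_factor_ge assms) auto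
    ultimately show ?thesis by linarith
  qed
  have geometric: "(1 + \<theta>) ^ k * (dist (x k) s)\<^sup>2 \<le> (dist x0 s)\<^sup>2"
    if s: "s \<in> equilibrium_points f" for s k
  proof (induction k)
    case (Suc k)
    have "(1 + \<theta>) ^ k * ((1 + \<theta>) * (dist (x (Suc k)) s)\<^sup>2) \<le> (1 + \<theta>) ^ k * (dist (x k) s)\<^sup>2"
      using contraction[OF s] theta by (intro mult_left_mono) auto
    with Suc show ?case by (simp add: mult_ac)
  qed (simp add: assms(8))
  have lim: "x \<longlonglongrightarrow> s" if s: "s \<in> equilibrium_points f" for s
  proof -
    have "(\<lambda>k. (dist x0 s)\<^sup>2 * inverse (1 + \<theta>) ^ k) \<longlonglongrightarrow> (dist x0 s)\<^sup>2 * 0"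
      using theta by (intro tendsto_mult_left LIMSEQ_realpow_zero) (auto simp: inverse_less_1_iff)
    then have lim0: "(\<lambda>k. (dist x0 s)\<^sup>2 * inverse (1 + \<theta>) ^ k) \<longlonglongrightarrow> 0"
      by (simp only: mult_zero_right)
    have "norm ((dist (x k) s)\<^sup>2) \<le> (dist x0 s)\<^sup>2 * inverse (1 + \<theta>) ^ k" for k
      using geometric[OF s, of k] theta by (simp add: field_simps)
    then have "(\<lambda>k. (dist (x k) s)\<^sup>2) \<longlonglongrightarrow> 0"
      by (intro Lim_null_comparison[OF always_eventually lim0] allI)
    then have "(\<lambda>k. sqrt ((dist (x k) s)\<^sup>2)) \<longlonglongrightarrow> sqrt 0"
      by (rule tendsto_real_sqrt)
    then show ?thesis
      by (subst tendsto_dist_iff) simp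
  qed
  obtain xs where xs: "xs \<in> equilibrium_points f"
    using assms(10) by blast
  then have "equilibrium_points f = {xs}"
    using LIMSEQ_unique[OF lim lim[OF xs]] by blast
  moreover have "dist (x k) xs <
      (12 * sqrt 3 * b * \<gamma>\<^sup>2 / (sqrt \<eta> * (\<gamma> - 12 * \<eta>) powr (3/2))) / sqrt (real k - 2)"
      (is "_ < ?C / _")
    if b: "b > 0" "b\<^sup>2 \<ge> (dist x0 xs)\<^sup>2" and k: "k > 2" for b k
  proof -
    have "((\<gamma> - 12 * \<eta>) powr (3/2))\<^sup>2 = (\<gamma> - 12 * \<eta>) ^ 3"
      using assms(6) by (simp add: powr_power powr_numeral)
    then have C2: "?C\<^sup>2 = 432 * b\<^sup>2 * \<gamma> ^ 4 / (\<eta> * (\<gamma> - 12 * \<eta>) ^ 3)"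
      using assms(2) by (simp add: power_mult_distrib power_divide)
    have "(\<gamma> - 12 * \<eta>)\<^sup>2 \<le> \<gamma>\<^sup>2"
      using assms(2,6) by (intro power_mono) auto
    then have le: "(\<gamma> - 12 * \<eta>)\<^sup>2 \<le> 432 * \<gamma>\<^sup>2"
      using zero_le_power2[of \<gamma>] by linarith
    \<comment> \<open>Expanding the fraction by \<open>(\<gamma> - 12 * \<eta>)^2\<close> produces
      the denominator of \<open>?C^2\<close>; the numerators then compare by \<open>le\<close>,
      where 432 is the square of \<open>12 * sqrt 3\<close>.\<close>
    have "b\<^sup>2 / \<theta> = b\<^sup>2 * \<gamma>\<^sup>2 * (\<gamma> - 12 * \<eta>)\<^sup>2 / (\<eta> * (\<gamma> - 12 * \<eta>) ^ 3)"
      using assms(1,2,6) by (simp add: \<theta>_def power2_eq_square power3_eq_cube)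
    also have "\<dots> \<le> b\<^sup>2 * \<gamma>\<^sup>2 * (432 * \<gamma>\<^sup>2) / (\<eta> * (\<gamma> - 12 * \<eta>) ^ 3)"
      using assms(2,6) le by (intro divide_right_mono mult_left_mono) auto
    also have "\<dots> = ?C\<^sup>2"
      unfolding C2 by (simp add: power4_eq_xxxx power2_eq_square)
    finally have C: "b\<^sup>2 / \<theta> \<le> ?C\<^sup>2" .
    have "(1 + real k * \<theta>) * (dist (x k) xs)\<^sup>2 \<le> (1 + \<theta>) ^ k * (dist (x k) xs)\<^sup>2"
      using theta Bernoulli_inequality[of \<theta> k] by (intro mult_right_mono) auto
    with geometric[OF xs, of k] b have bound: "(1 + real k * \<theta>) * (dist (x k) xs)\<^sup>2 \<le> b\<^sup>2"
      by linarith
    have pos: "1 + real k * \<theta> > 0"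
      using theta by (simp add: add_pos_nonneg)
    with bound have "(dist (x k) xs)\<^sup>2 \<le> b\<^sup>2 / (1 + real k * \<theta>)"
      by (simp add: field_simps)
    \<comment> \<open>The strictness of the final bound arises here: the denominators differ by
      \<open>1 + 2 * \<theta> > 0\<close>, and \<open>k > 2\<close> keeps the smaller one
      positive.\<close>
    also have "\<dots> < b\<^sup>2 / (\<theta> * (real k - 2))"
    proof (rule divide_strict_left_mono)
      show "\<theta> * (real k - 2) < 1 + real k * \<theta>"
        using theta by (simp add: algebra_simps)
      show "0 < (1 + real k * \<theta>) * (\<theta> * (real k - 2))"
        using theta k pos by (intro mult_pos_pos) auto
    qed (use b in simp)
    also have "\<dots> \<le> ?C\<^sup>2 / (real k - 2)"
      using divide_right_mono[OF C, of "real k - 2"] k by simp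
    also have "\<dots> = (?C / sqrt (real k - 2))\<^sup>2"
      using k by (simp add: power_divide[of ?C "sqrt (real k - 2)"] del: divide_divide_eq_left)
    finally have "(dist (x k) xs)\<^sup>2 < (?C / sqrt (real k - 2))\<^sup>2" .
    then show ?thesis
      by (rule power2_less_imp_less) (use assms(2) b k in simp)
  qed
  ultimately show ?thesis
    using lim[OF xs] by blast
qed

end
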